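(* Let $\mathcal{C}$ be a finite family of $x$-monotone curves in the plane such that every element of $\mathcal{C}$ has nonempty intersection with a fixed vertical line $l$, and let $G$ be the disjointness graph of $\mathcal{C}$. If $\omega(G)=k$, then $\chi(G)\leq \frac{k+1}{2}\binom{k+2}{3}$.
   Context: A curve is the image of a continuous map $\phi:[0,1]\to\mathbb{R}^2$. A curve is $x$-monotone if every vertical line meets it in at most one point. The disjointness graph of a family of curves has the curves as vertices, two vertices being adjacent if and only if the corresponding curves are disjoint. $\omega$ and $\chi$ denote clique number and chromatic number. *)

theory Defs
  imports "HOL-Analysis.Analysis" "HOL-Library.Ramsey"
begin

definition curve :: "(real \<times> real) set \<Rightarrow> bool" where
  "curve \<gamma> \<longleftrightarrow> (\<exists>\<phi>. path \<phi> \<and> \<gamma> = path_image \<phi>)"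

definition vertical_line :: "real \<Rightarrow> (real \<times> real) set" where
  "vertical_line a = {p. fst p = a}"

definition x_monotone :: "(real \<times> real) set \<Rightarrow> bool" where
  "x_monotone \<gamma> \<longleftrightarrow> (\<forall>a. \<exists>\<^sub>\<le>\<^sub>1 p. p \<in> \<gamma> \<inter> vertical_line a)"

text \<open>
  A simple graph is given by a vertex set \<open>V\<close> and a set \<open>E\<close> of two-element subsets of \<open>V\<close>,
  the representation for which \<^const>\<open>clique\<close> is defined.
\<close>

definition disjointness_edges :: "'a set set \<Rightarrow> 'a set set set" where
  "disjointness_edges \<C> = {{A, B} | A B. A \<in> \<C> \<and> B \<in> \<C> \<and> A \<noteq> B \<and> disjnt A B}"

text \<open>
  Both invariants below are meaningful for finite \<open>V\<close>: then the maximum is over a finite set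
  containing \<open>card {}\<close>, and a proper colouring with \<open>card V\<close> colours exists.
\<close>

definition clique_number :: "'v set \<Rightarrow> 'v set set \<Rightarrow> nat" where
  "clique_number V E = Max {card K | K. K \<subseteq> V \<and> clique K E}"

definition proper_colouring :: "'v set \<Rightarrow> 'v set set \<Rightarrow> nat \<Rightarrow> ('v \<Rightarrow> nat) \<Rightarrow> bool" where
  "proper_colouring V E n f \<longleftrightarrow>
     f ` V \<subseteq> {..<n} \<and> (\<forall>u\<in>V. \<forall>v\<in>V. {u, v} \<in> E \<longrightarrow> f u \<noteq> f v)"

definition chromatic_number :: "'v set \<Rightarrow> 'v set set \<Rightarrow> nat" where
  "chromatic_number V E = (LEAST n. \<exists>f. proper_colouring V E n f)"

end

theory Submission
  imports Defs
begin

text \<open>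
  Every curve is the graph of a continuous function over an interval around \<open>c\<close>, and two disjoint
  curves are ordered vertically; write \<open>R u v\<close> if \<open>u\<close> lies below \<open>v\<close>. This relation can only fail
  to be transitive at \<open>x, v, w\<close> if the middle curve \<open>v\<close> ends before both \<open>x\<close> and \<open>w\<close> on one side.
  For each of the two sides choose whether to require that no curve of the clique reaches
  further than its top element. The four maximum sizes of a clique with top element \<open>v\<close> under
  these requirements label \<open>v\<close>. If \<open>R u v\<close>, then every clique with top element \<open>u\<close> that meets the
  requirements on exactly those sides where \<open>v\<close> reaches at least as far as \<open>u\<close> can be extended by
  \<open>v\<close>, so the corresponding label increases strictly. Weaker requirements give larger labels, and all labels
  lie in \<open>{1..k}\<close>, so it remains to count the monotone \<open>2 \<times> 2\<close> arrays with entries in \<open>{1..k}\<close>.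
\<close>

section \<open>Colourings and the number of possible labels\<close>

lemma chromatic_number_le_card:
  assumes "finite T" "g ` V \<subseteq> T"
    and proper: "\<And>u v. \<lbrakk>u \<in> V; v \<in> V; {u, v} \<in> E\<rbrakk> \<Longrightarrow> g u \<noteq> g v"
  shows "chromatic_number V E \<le> card T"
proof -
  \<comment> \<open>Colours may come from any finite set, later one of quadruples, so they are
    renumbered.\<close>
  obtain h where h: "bij_betw h T {..<card T}"
    using ex_bij_betw_finite_nat[OF \<open>finite T\<close>] by (auto simp: atLeast0LessThan)
  have "proper_colouring V E (card T) (h \<circ> g)"
    unfolding proper_colouring_def
  proof (intro conjI ballI impI)
    show "(h \<circ> g) ` V \<subseteq> {..<card T}"
      using bij_betw_imp_surj_on[OF h] assms(2) by auto
    show "(h \<circ> g) u \<noteq> (h \<circ> g) v" if "u \<in> V" "v \<in> V" "{u, v} \<in> E" for u v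
      using proper[OF that] inj_onD[OF bij_betw_imp_inj_on[OF h]] assms(2) that by auto
  qed
  then show ?thesis
    unfolding chromatic_number_def by (blast intro: Least_le)
qed

text \<open>The tuple \<open>(s, p, q, r)\<close> lists the maximum, the minimum and the two incomparable entries.\<close>

definition monotone_arrays :: "nat \<Rightarrow> (nat \<times> nat \<times> nat \<times> nat) set" where
  "monotone_arrays k = (SIGMA s : {1..k}. SIGMA p : {1..s}. {p..s} \<times> {p..s})"

lemma finite_monotone_arrays: "finite (monotone_arrays k)"
  by (simp add: monotone_arrays_def)

lemma six_times_sum_squares: "6 * (\<Sum>p = 1..s. (s + 1 - p)\<^sup>2) = s * (s + 1) * (2 * s + 1)" for s :: nat
proof -
  have "(\<Sum>p = 1..s. (s + 1 - p)\<^sup>2) = (\<Sum>d = 1..s. d\<^sup>2)"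
    by (rule sum.reindex_bij_witness[where i = "\<lambda>d. s + 1 - d" and j = "\<lambda>p. s + 1 - p"]) auto
  moreover have "6 * (\<Sum>d = 1..s. d\<^sup>2) = s * (s + 1) * (2 * s + 1)"
    by (induction s) (simp_all add: algebra_simps power2_eq_square)
  ultimately show ?thesis by simp
qed

lemma card_monotone_arrays: "12 * card (monotone_arrays k) = k * (k + 1)\<^sup>2 * (k + 2)"
proof -
  \<comment> \<open>With maximum \<open>s\<close> and minimum \<open>p\<close> fixed, each of the
    two incomparable entries independently takes \<open>s + 1 - p\<close> values.\<close>
  have "card (monotone_arrays k) = (\<Sum>s = 1..k. \<Sum>p = 1..s. (s + 1 - p)\<^sup>2)"
    by (simp add: monotone_arrays_def power2_eq_square)
  then have "12 * card (monotone_arrays k) = 2 * (\<Sum>s = 1..k. 6 * (\<Sum>p = 1..s. (s + 1 - p)\<^sup>2))"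
    by (simp add: sum_distrib_left)
  also have "\<dots> = 2 * (\<Sum>s = 1..k. s * (s + 1) * (2 * s + 1))"
    by (simp only: six_times_sum_squares)
  also have "\<dots> = k * (k + 1)\<^sup>2 * (k + 2)"
    by (induction k) (simp_all add: algebra_simps power2_eq_square)
  finally show ?thesis .
qed

lemma six_times_choose_three: "6 * ((k + 2) choose 3) = k * (k + 1) * (k + 2)"
proof (induction k)
  case (Suc k)
  have "(Suc k + 2) choose 3 = ((k + 2) choose 2) + ((k + 2) choose 3)"
    by (simp add: numeral_3_eq_3 numeral_2_eq_2)
  moreover have "2 * ((k + 2) choose 2) = (k + 2) * (k + 1)"
    by (simp add: choose_two)
  ultimately show ?case
    using Suc by (simp add: algebra_simps)
qed simp

lemma real_card_monotone_arrays:
  "real (card (monotone_arrays k)) = (real k + 1) / 2 * real ((k + 2) choose 3)"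
proof -
  have "12 * card (monotone_arrays k) = (k + 1) * (6 * ((k + 2) choose 3))"
    unfolding card_monotone_arrays six_times_choose_three
    by (simp add: power2_eq_square algebra_simps)
  then have "2 * card (monotone_arrays k) = (k + 1) * ((k + 2) choose 3)"
    by simp
  then have "real (2 * card (monotone_arrays k)) = real ((k + 1) * ((k + 2) choose 3))"
    by (simp only:)
  then show ?thesis
    by (simp add: algebra_simps)
qed

section \<open>Labels in an abstract order with two reaches\<close>

locale two_sided_order =
  fixes V :: "'v set" and E :: "'v set set" and R :: "'v \<Rightarrow> 'v \<Rightarrow> bool" and a b :: "'v \<Rightarrow> real"
  assumes finite_V: "finite V"
    and edge_iff: "\<And>u v. \<lbrakk>u \<in> V; v \<in> V\<rbrakk> \<Longrightarrow> {u, v} \<in> E \<longleftrightarrow> R u v \<or> R v u"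
    and irrefl: "\<And>v. v \<in> V \<Longrightarrow> \<not> R v v"
    and weak_trans: "\<And>x v w. \<lbrakk>x \<in> V; v \<in> V; w \<in> V; R x v; R v w;
      a x \<le> a v \<or> a w \<le> a v; b x \<le> b v \<or> b w \<le> b v\<rbrakk> \<Longrightarrow> R x w"
begin

definition cliques_below :: "bool \<Rightarrow> bool \<Rightarrow> 'v \<Rightarrow> 'v set set" where
  "cliques_below s t v = {K. K \<subseteq> V \<and> clique K E \<and> v \<in> K \<and> (\<forall>x \<in> K - {v}. R x v) \<and>
     (s \<longrightarrow> (\<forall>x\<in>K. a x \<le> a v)) \<and> (t \<longrightarrow> (\<forall>x\<in>K. b x \<le> b v))}"

definition label :: "bool \<Rightarrow> bool \<Rightarrow> 'v \<Rightarrow> nat" where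
  "label s t v = Max (card ` cliques_below s t v)"

lemma finite_cliques_below: "finite (cliques_below s t v)"
  by (rule finite_subset[of _ "Pow V"]) (auto simp: cliques_below_def finite_V)

text \<open>Makes the maximum in \<open>label\<close> one over a nonempty set, and makes labels
  start at 1.\<close>

lemma singleton_in_cliques_below: "v \<in> V \<Longrightarrow> {v} \<in> cliques_below s t v"
  by (auto simp: cliques_below_def clique_def)

lemma card_le_label: "K \<in> cliques_below s t v \<Longrightarrow> card K \<le> label s t v"
  by (simp add: label_def finite_cliques_below)

lemma label_witness:
  assumes "v \<in> V"
  obtains K where "K \<in> cliques_below s t v" "card K = label s t v"
proof -
  have "label s t v \<in> card ` cliques_below s t v"
    unfolding label_def using singleton_in_cliques_below[OF assms, of s t] finite_cliques_below
    by (intro Max_in) auto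
  then show ?thesis using that by auto
qed

lemma label_pos: "v \<in> V \<Longrightarrow> 1 \<le> label s t v"
  using card_le_label[OF singleton_in_cliques_below] by simp

lemma label_le_clique_number:
  assumes "v \<in> V"
  shows "label s t v \<le> clique_number V E"
proof -
  obtain K where K: "K \<in> cliques_below s t v" "card K = label s t v"
    using label_witness[OF assms] .
  have "finite {card K | K. K \<subseteq> V \<and> clique K E}"
    using finite_V by simp
  then have "card K \<le> clique_number V E"
    unfolding clique_number_def using K(1) by (intro Max_ge) (auto simp: cliques_below_def)
  then show ?thesis using K(2) by simp
qed

lemma label_mono:
  assumes "v \<in> V" "s' \<Longrightarrow> s" "t' \<Longrightarrow> t"
  shows "label s t v \<le> label s' t' v"
proof -
  obtain K where K: "K \<in> cliques_below s t v" "card K = label s t v"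
    using label_witness[OF assms(1)] .
  then have "K \<in> cliques_below s' t' v"
    using assms by (auto simp: cliques_below_def)
  then show ?thesis
    using card_le_label K(2) by metis
qed

lemma label_less:
  assumes "u \<in> V" "v \<in> V" "R u v"
  shows "label (a u \<le> a v) (b u \<le> b v) u < label (a u \<le> a v) (b u \<le> b v) v"
proof -
  obtain K where K: "K \<in> cliques_below (a u \<le> a v) (b u \<le> b v) u"
      "card K = label (a u \<le> a v) (b u \<le> b v) u"
    using label_witness[OF assms(1)] .
  have "finite K"
    using K(1) finite_V by (auto simp: cliques_below_def intro: finite_subset)
  have below: "R x v" if "x \<in> K" for x
  proof (cases "x = u")
    case False
    \<comment> \<open>On each side, either the requirement is in force and bounds the reach of
      \<open>x\<close> by that of \<open>u\<close>, or it is off because \<open>v\<close> reaches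
      less far than \<open>u\<close>. Both cases suit \<open>weak_trans\<close> with
      \<open>u\<close> in the middle.\<close>
    then have "x \<in> V" "R x u" "a x \<le> a u \<or> a v \<le> a u" "b x \<le> b u \<or> b v \<le> b u"
      using K(1) that by (auto simp: cliques_below_def)
    then show ?thesis using weak_trans[of x u v] assms by blast
  qed (use assms in simp)
  have "v \<notin> K"
    using below irrefl assms(2) by blast
  have "{x, v} \<in> E" if "x \<in> K" for x
    using below[OF that] edge_iff[of x v] K(1) that assms(2) by (auto simp: cliques_below_def)
  \<comment> \<open>A requirement is in force only if \<open>v\<close> reaches at least as far as
    \<open>u\<close>, so it survives the change of top element.\<close>
  then have "insert v K \<in> cliques_below (a u \<le> a v) (b u \<le> b v) v"
    using K(1) below assms(2)
    by (auto simp: cliques_below_def clique_def insert_commute intro: order_trans)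
  from card_le_label[OF this] show ?thesis
    using K(2) \<open>v \<notin> K\<close> \<open>finite K\<close> by simp
qed

theorem chromatic_number_le:
  "chromatic_number V E \<le> card (monotone_arrays (clique_number V E))"
proof (rule chromatic_number_le_card)
  let ?g = "\<lambda>v. (label False False v, label True True v, label True False v, label False True v)"
  show "?g ` V \<subseteq> monotone_arrays (clique_number V E)"
    by (auto simp: monotone_arrays_def label_le_clique_number intro!: label_mono
        dest: label_pos[unfolded One_nat_def])
  \<comment> \<open>Which label increases strictly depends on the pair, but it is always one of the
    four coordinates.\<close>
  have "?g u \<noteq> ?g v" if "u \<in> V" "v \<in> V" "R u v" for u v
    using label_less[OF that] by (cases "a u \<le> a v"; cases "b u \<le> b v") auto
  then show "?g u \<noteq> ?g v" if "u \<in> V" "v \<in> V" "{u, v} \<in> E" for u v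
    using edge_iff[of u v] that by metis
qed (rule finite_monotone_arrays)

end

section \<open>Curves as graphs of continuous functions\<close>

lemma x_monotone_curve_graph:
  assumes "curve \<gamma>" "x_monotone \<gamma>" "\<gamma> \<inter> vertical_line c \<noteq> {}"
  obtains l r h where "l \<le> c" "c \<le> r" "continuous_on {l..r} h" "\<gamma> = (\<lambda>x. (x, h x)) ` {l..r}"
proof -
  have compact: "compact \<gamma>" and conn: "connected \<gamma>"
    using assms(1) by (auto simp: curve_def compact_path_image connected_path_image)
  obtain l r where lr: "fst ` \<gamma> = {l..r}"
    using connected_compact_interval_1[of "fst ` \<gamma>"] compact conn
    by (auto simp: compact_continuous_image connected_continuous_image continuous_on_fst)
  have inj: "inj_on fst \<gamma>"
    using assms(2) by (auto simp: inj_on_def x_monotone_def vertical_line_def Uniq_def)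
  define g where "g = the_inv_into \<gamma> fst"
  have g: "g (fst p) = p" if "p \<in> \<gamma>" for p
    by (simp add: g_def inj that the_inv_into_f_f)
  \<comment> \<open>A continuous injection on a compact set has a continuous inverse.\<close>
  have cont: "continuous_on {l..r} g"
    using continuous_on_inv[of \<gamma> fst g] compact g lr by (simp add: continuous_on_fst)
  have "\<gamma> = g ` {l..r}"
    using g by (force simp flip: lr)
  moreover have "g x = (x, snd (g x))" if "x \<in> {l..r}" for x
    using that g by (auto simp flip: lr)
  ultimately have "\<gamma> = (\<lambda>x. (x, snd (g x))) ` {l..r}"
    by (metis (no_types, lifting) image_cong)
  moreover have "c \<in> {l..r}"
    using assms(3) by (force simp: vertical_line_def simp flip: lr)
  ultimately show ?thesis
    using that[of l r "\<lambda>x. snd (g x)"] cont by (auto intro: continuous_on_snd)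
qed

text \<open>Otherwise \<open>g - f\<close> is positive at \<open>c\<close> and at most 0 at
  \<open>x\<close>, so it vanishes somewhere on the connected set \<open>S\<close>.\<close>

lemma continuous_nowhere_equal_imp_less:
  fixes f g :: "real \<Rightarrow> real"
  assumes "continuous_on S f" "continuous_on S g" "connected S"
    and ne: "\<And>x. x \<in> S \<Longrightarrow> f x \<noteq> g x"
    and "c \<in> S" "f c < g c" "x \<in> S"
  shows "f x < g x"
proof (rule ccontr)
  assume "\<not> f x < g x"
  have "connected ((\<lambda>x. g x - f x) ` S)"
    using assms by (intro connected_continuous_image continuous_intros)
  moreover have "g x - f x \<le> 0" "0 \<le> g c - f c"
    using \<open>\<not> f x < g x\<close> assms(6) by auto
  ultimately have "0 \<in> (\<lambda>x. g x - f x) ` S"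
    using assms(5,7) unfolding connected_iff_interval by blast
  then show False using ne by force
qed

theorem theorem3:
  fixes \<C> :: "(real \<times> real) set set" and c :: real and k :: nat
  assumes "finite \<C>"
    and "\<And>\<gamma>. \<gamma> \<in> \<C> \<Longrightarrow> curve \<gamma>"
    and "\<And>\<gamma>. \<gamma> \<in> \<C> \<Longrightarrow> x_monotone \<gamma>"
    and "\<And>\<gamma>. \<gamma> \<in> \<C> \<Longrightarrow> \<gamma> \<inter> vertical_line c \<noteq> {}"
    and "clique_number \<C> (disjointness_edges \<C>) = k"
  shows "real (chromatic_number \<C> (disjointness_edges \<C>))
           \<le> (real k + 1) / 2 * real ((k + 2) choose 3)"
proof -
  have "\<forall>\<gamma>\<in>\<C>. \<exists>l r h. l \<le> c \<and> c \<le> r \<and> continuous_on {l..r} h \<and> \<gamma> = (\<lambda>x. (x, h x)) ` {l..r}"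
    using assms(2-4) x_monotone_curve_graph by metis
  then obtain l r h where lr: "\<And>\<gamma>. \<gamma> \<in> \<C> \<Longrightarrow> l \<gamma> \<le> c" "\<And>\<gamma>. \<gamma> \<in> \<C> \<Longrightarrow> c \<le> r \<gamma>"
    and cont: "\<And>\<gamma>. \<gamma> \<in> \<C> \<Longrightarrow> continuous_on {l \<gamma>..r \<gamma>} (h \<gamma>)"
    and graph: "\<And>\<gamma>. \<gamma> \<in> \<C> \<Longrightarrow> \<gamma> = (\<lambda>x. (x, h \<gamma> x)) ` {l \<gamma>..r \<gamma>}"
    by metis
  define I where "I u v = {l u..r u} \<inter> {l v..r v}" for u v
  define R where "R u v \<longleftrightarrow> (\<forall>x \<in> I u v. h u x < h v x)" for u v
  \<comment> \<open>Hence \<open>R\<close> never holds vacuously on the family, and heights at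
    \<open>c\<close> decide which of two disjoint curves is lower.\<close>
  have c_mem: "c \<in> I u v" if "u \<in> \<C>" "v \<in> \<C>" for u v
    using lr that by (simp add: I_def)
  have disjnt_graphs: "disjnt u v \<longleftrightarrow> (\<forall>x \<in> I u v. h u x \<noteq> h v x)" if "u \<in> \<C>" "v \<in> \<C>" for u v
  proof -
    have "disjnt ((\<lambda>x. (x, h u x)) ` {l u..r u}) ((\<lambda>x. (x, h v x)) ` {l v..r v})
        \<longleftrightarrow> (\<forall>x \<in> I u v. h u x \<noteq> h v x)"
      by (fastforce simp: disjnt_iff I_def)
    then show ?thesis
      using graph that by metis
  qed
  have R_if_less: "R u v" if "u \<in> \<C>" "v \<in> \<C>" "disjnt u v" "h u c < h v c" for u v
    unfolding R_def
  proof
    fix x assume "x \<in> I u v"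
    show "h u x < h v x"
    proof (rule continuous_nowhere_equal_imp_less[where f = "h u" and g = "h v" and S = "I u v"])
      show "continuous_on (I u v) (h u)" "continuous_on (I u v) (h v)"
        unfolding I_def using cont that by (blast intro: continuous_on_subset)+
      show "connected (I u v)"
        by (simp add: I_def)
    qed (use that disjnt_graphs c_mem \<open>x \<in> I u v\<close> in auto)
  qed
  have edge_iff: "{u, v} \<in> disjointness_edges \<C> \<longleftrightarrow> R u v \<or> R v u" if "u \<in> \<C>" "v \<in> \<C>" for u v
  proof -
    have "{u, v} \<in> disjointness_edges \<C> \<longleftrightarrow> u \<noteq> v \<and> disjnt u v"
      using that by (auto simp: disjointness_edges_def doubleton_eq_iff disjnt_sym)
    also have "\<dots> \<longleftrightarrow> R u v \<or> R v u"
    proof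
      assume "u \<noteq> v \<and> disjnt u v"
      moreover from this have "h u c \<noteq> h v c"
        using disjnt_graphs c_mem that by blast
      ultimately show "R u v \<or> R v u"
        using R_if_less that by (meson disjnt_sym linorder_neqE_linordered_idom)
    next
      assume "R u v \<or> R v u"
      moreover have "I v u = I u v"
        by (auto simp: I_def)
      ultimately show "u \<noteq> v \<and> disjnt u v"
        using disjnt_graphs[OF that] c_mem[OF that] unfolding R_def by fastforce
    qed
    finally show ?thesis .
  qed
  \<comment> \<open>Reaching further means larger \<open>r\<close> on the right and larger
    \<open>- l\<close> on the left.\<close>
  interpret two_sided_order \<C> "disjointness_edges \<C>" R r "\<lambda>\<gamma>. - l \<gamma>"
  proof
    show "\<not> R v v" if "v \<in> \<C>" for v
      using c_mem[OF that that] by (auto simp: R_def)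
    show "R x w" if "R x v" "R v w" "r x \<le> r v \<or> r w \<le> r v" "- l x \<le> - l v \<or> - l w \<le> - l v" for x v w
      unfolding R_def
    proof
      fix y assume "y \<in> I x w"
      \<comment> \<open>On each side \<open>v\<close> reaches at least as far as \<open>x\<close> or
        as \<open>w\<close>, so it is defined wherever both are, and the heights can be compared
        pointwise.\<close>
      then have "y \<in> I x v" "y \<in> I v w"
        using that(3,4) by (auto simp: I_def)
      then show "h x y < h w y"
        using that(1,2) unfolding R_def by (meson order_less_trans)
    qed
  qed (use assms(1) edge_iff in auto)
  have "chromatic_number \<C> (disjointness_edges \<C>) \<le> card (monotone_arrays k)"
    using chromatic_number_le assms(5) by simp
  then show ?thesis
    unfolding real_card_monotone_arrays[symmetric] by simp
qed

end
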